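(* Consider the finite-horizon uniformized relaxation of the Poisson-arrival matching system with $N\ge2$ types, in which at each decision epoch the controller either waits or, if $\mathbf{x}\in\mathcal F=\{\mathbf{x}\in\mathbb{Z}_+^N:\min_i x_i\ge1\}$, executes one complete-tuple match. Suppose the matching-cost function $f:\mathbb{Z}_+^N\to\mathbb{R}_+$ is convex, supermodular, and component-wise non-increasing. Then, at every finite horizon, the set of feasible states at which matching is an optimal action is closed upward in queue lengths: if matching is optimal at state $\mathbf{x}\in\mathcal F$, then matching is also optimal at any state $\mathbf{y}\in\mathcal F$ with $\mathbf{y}\succeq\mathbf{x}$ (componentwise).
   Context: **Properties of $f$.** With $\mathbf{e}_i$ the standard basis vectors, $f$ is called convex, supermodular, and component-wise non-increasing if for all $\mathbf{x}\in\mathbb{Z}_+^N$: - convexity: $2f(\mathbf{x}+\mathbf{e}_i)\le f(\mathbf{x})+f(\mathbf{x}+2\mathbf{e}_i)$ for all $i$; - supermodularity: $f(\mathbf{x}+\mathbf{e}_i)+f(\mathbf{x}+\mathbf{e}_j)\le f(\mathbf{x})+f(\mathbf{x}+\mathbf{e}_i+\mathbf{e}_j)$ for all $i\ne j$; - component-wise non-increasing: $f(\mathbf{x}+\mathbf{e}_i)\le f(\mathbf{x})$ for all $i$. **Finite-horizon uniformized dynamic program.** Type-$i$ agents arrive as a Poisson process of rate $\lambda_i>0$; type-$i$ agents incur waiting cost at rate $c_i>0$; $w(\mathbf{x})=\sum_{i=1}^N c_ix_i$. Fix a uniformization rate $\Lambda>\sum_{i=1}^N\lambda_i$ and for a function $g$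 on $\mathbb{Z}_+^N$ let $$\mathcal U g(\mathbf{x})=\Big(1-\sum_{i=1}^N\tfrac{\lambda_i}{\Lambda}\Big)g(\mathbf{x})+\sum_{i=1}^N\tfrac{\lambda_i}{\Lambda}g(\mathbf{x}+\mathbf{e}_i).$$ Set $J_0\equiv0$. For $k\ge0$, the wait and match action values of the $(k+1)$-stage problem are $$J^0_{k+1}(\mathbf{x})=\frac{w(\mathbf{x})}{\Lambda}+\mathcal U J_k(\mathbf{x}),\qquad J^1_{k+1}(\mathbf{x})=f(\mathbf{x})+\frac{w(\mathbf{x}-\mathbf{1})}{\Lambda}+\mathcal U J_k(\mathbf{x}-\mathbf{1})\quad(\mathbf{x}\in\mathcal F),$$ where $\mathbf{1}=(1,\dots,1)$. The optimal value is $J_{k+1}(\mathbf{x})=\min\{J^0_{k+1}(\mathbf{x}),J^1_{k+1}(\mathbf{x})\}$ if $\mathbf{x}\in\mathcal F$, and $J_{k+1}(\mathbf{x})=J^0_{k+1}(\mathbf{x})$ otherwise. Matching is optimal at $\mathbf{x}\in\mathcal F$ in the $(k+1)$-stage problem iff $J^1_{k+1}(\mathbf{x})\le J^0_{k+1}(\mathbf{x})$ (ties count as matching being optimal). *)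

theory Defs
  imports "HOL-Analysis.Analysis"
begin

(* Queue states are vectors nat ^ 'n, where 'n is the finite set of agent types (N = CARD('n)).
   The order on them is componentwise, axis i 1 is the i-th standard basis vector, and 1 is the
   all-ones vector. *)

definition coordinatewise_convex :: "(nat ^ 'n \<Rightarrow> real) \<Rightarrow> bool" where
  "coordinatewise_convex f \<longleftrightarrow>
     (\<forall>x i. 2 * f (x + axis i 1) \<le> f x + f (x + axis i 2))"

definition supermodular :: "(nat ^ 'n \<Rightarrow> real) \<Rightarrow> bool" where
  "supermodular f \<longleftrightarrow>
     (\<forall>x i j. i \<noteq> j \<longrightarrow>
        f (x + axis i 1) + f (x + axis j 1) \<le> f x + f (x + axis i 1 + axis j 1))"

definition coordinatewise_nonincreasing :: "(nat ^ 'n \<Rightarrow> real) \<Rightarrow> bool" where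
  "coordinatewise_nonincreasing f \<longleftrightarrow> (\<forall>x i. f (x + axis i 1) \<le> f x)"

definition feasible_states :: "(nat ^ 'n) set" where
  "feasible_states = {x. 1 \<le> Min (range (\<lambda>i. x $ i))}"

definition waiting_cost :: "real ^ 'n \<Rightarrow> nat ^ 'n \<Rightarrow> real" where
  "waiting_cost c x = (\<Sum>i\<in>UNIV. c $ i * real (x $ i))"

(* l is the vector of arrival rates and \<Lambda> the uniformization rate. *)
definition uniformized :: "real ^ 'n \<Rightarrow> real \<Rightarrow> (nat ^ 'n \<Rightarrow> real) \<Rightarrow> nat ^ 'n \<Rightarrow> real" where
  "uniformized l \<Lambda> g x =
     (1 - (\<Sum>i\<in>UNIV. l $ i / \<Lambda>)) * g x + (\<Sum>i\<in>UNIV. l $ i / \<Lambda> * g (x + axis i 1))"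

definition wait_action :: "real ^ 'n \<Rightarrow> real ^ 'n \<Rightarrow> real \<Rightarrow> (nat ^ 'n \<Rightarrow> real) \<Rightarrow> nat ^ 'n \<Rightarrow> real" where
  "wait_action l c \<Lambda> J x = waiting_cost c x / \<Lambda> + uniformized l \<Lambda> J x"

(* Meaningful only on feasible_states, where the truncated subtraction x - 1 is exact. *)
definition match_action ::
  "real ^ 'n \<Rightarrow> real ^ 'n \<Rightarrow> real \<Rightarrow> (nat ^ 'n \<Rightarrow> real) \<Rightarrow> (nat ^ 'n \<Rightarrow> real) \<Rightarrow> nat ^ 'n \<Rightarrow> real" where
  "match_action l c \<Lambda> f J x =
     f x + waiting_cost c (x - 1) / \<Lambda> + uniformized l \<Lambda> J (x - 1)"

primrec optimal_value ::
  "real ^ 'n \<Rightarrow> real ^ 'n \<Rightarrow> real \<Rightarrow> (nat ^ 'n \<Rightarrow> real) \<Rightarrow> nat \<Rightarrow> nat ^ 'n \<Rightarrow> real" where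
  "optimal_value l c \<Lambda> f 0 = (\<lambda>x. 0)"
| "optimal_value l c \<Lambda> f (Suc k) = (\<lambda>x.
     if x \<in> feasible_states
     then min (wait_action l c \<Lambda> (optimal_value l c \<Lambda> f k) x)
              (match_action l c \<Lambda> f (optimal_value l c \<Lambda> f k) x)
     else wait_action l c \<Lambda> (optimal_value l c \<Lambda> f k) x)"

(* The feasible states at which matching is optimal, ties included, in the problem with k + 1
   stages, i.e. with k stages to go after the current decision. *)
definition matching_optimal_states ::
  "real ^ 'n \<Rightarrow> real ^ 'n \<Rightarrow> real \<Rightarrow> (nat ^ 'n \<Rightarrow> real) \<Rightarrow> nat \<Rightarrow> (nat ^ 'n) set" where
  "matching_optimal_states l c \<Lambda> f k =
     {x \<in> feasible_states. match_action l c \<Lambda> f (optimal_value l c \<Lambda> f k) x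
                           \<le> wait_action l c \<Lambda> (optimal_value l c \<Lambda> f k) x}"

end

theory Submission
  imports Defs
begin

text \<open>
  Let G be the value of waiting, J the value function, and let the gain of matching at
  \<open>x + 1\<close> be \<open>d x = G (x + 1) - G x - f (x + 1)\<close>; it has to be shown nondecreasing. The increment
  \<open>J (x + 1) - J x\<close> itself is not monotone, but after subtracting \<open>f (x + 1)\<close> it becomes, one
  stage later, \<open>min (d x) 0\<close> plus the positive part of \<open>d (x - 1)\<close> (absent for infeasible
  \<open>x\<close>), which inherits monotonicity from d. Conversely, uniformization turns this excess back
  into d up to a constant and the drift of f, which is nondecreasing because convexity and
  supermodularity together say that f has nondecreasing differences.
\<close>

text \<open>A componentwise larger state is reached by unit steps, each in a coordinate still below
  its target, so the induction is on the total distance left.\<close>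

lemma mono_vec_natI:
  fixes g :: "nat ^ 'n \<Rightarrow> 'a::order"
  assumes step: "\<And>x i. g x \<le> g (x + axis i 1)"
  shows "mono g"
proof
  fix x y :: "nat ^ 'n"
  assume "x \<le> y"
  then show "g x \<le> g y"
  proof (induction "\<Sum>i\<in>UNIV. y $ i - x $ i" arbitrary: x rule: less_induct)
    case less
    show ?case
    proof (cases "x = y")
      case False
      with less.prems obtain i where i: "x $ i < y $ i"
        by (metis less_eq_vec_def le_neq_implies_less vec_eq_iff)
      have le: "x + axis i 1 \<le> y"
        using i less.prems by (auto simp: less_eq_vec_def axis_def)
      have "(\<Sum>j\<in>UNIV. y $ j - (x + axis i 1) $ j) < (\<Sum>j\<in>UNIV. y $ j - x $ j)"
        using i by (intro sum_strict_mono_ex1) (auto simp: axis_def intro!: exI[of _ i])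
      from less.hyps[OF this le] step[of x i] show ?thesis
        by (rule order_trans[rotated])
    qed simp
  qed
qed

lemma feasible_states_iff: "x \<in> feasible_states \<longleftrightarrow> 1 \<le> x"
  by (simp add: feasible_states_def less_eq_vec_def)

lemma feasible_statesE:
  assumes "x \<in> feasible_states"
  obtains z where "x = z + 1" "x - 1 = z"
proof
  show "x = (x - 1) + 1"
    using assms by (simp add: feasible_states_iff less_eq_vec_def vec_eq_iff del: One_nat_def)
qed simp

text \<open>Convexity covers a unit step in direction \<open>j\<close> itself, supermodularity a
  step in any other direction.\<close>

lemma mono_forward_difference:
  fixes f :: "nat ^ 'n \<Rightarrow> real"
  assumes conv: "coordinatewise_convex f" and super: "supermodular f"
  shows "mono (\<lambda>x. f (x + axis j 1) - f x)"
proof (rule mono_vec_natI)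
  fix x :: "nat ^ 'n" and i
  show "f (x + axis j 1) - f x \<le> f (x + axis i 1 + axis j 1) - f (x + axis i 1)"
  proof (cases "i = j")
    case True
    have "x + axis j 1 + axis j 1 = x + axis j 2"
      by (simp add: vec_eq_iff axis_def)
    moreover have "2 * f (x + axis j 1) \<le> f x + f (x + axis j 2)"
      using conv by (simp add: coordinatewise_convex_def)
    ultimately show ?thesis
      using True by simp
  next
    case False
    then have "f (x + axis i 1) + f (x + axis j 1) \<le> f x + f (x + axis i 1 + axis j 1)"
      using super by (simp add: supermodular_def)
    then show ?thesis by simp
  qed
qed

text \<open>Since \<Lambda> exceeds the total arrival rate, the weight of staying put is nonnegative
  too, so this is an average of monotone functions.\<close>

lemma mono_uniformized:
  fixes l :: "real ^ 'n"
  assumes l: "\<And>i. 0 \<le> l $ i" and \<Lambda>: "(\<Sum>i\<in>UNIV. l $ i) < \<Lambda>" and g: "mono g"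
  shows "mono (uniformized l \<Lambda> g)"
proof
  fix x y :: "nat ^ 'n"
  assume "x \<le> y"
  have "0 < \<Lambda>"
    using sum_nonneg[of UNIV "\<lambda>i. l $ i"] l \<Lambda> by simp
  then have "0 \<le> 1 - (\<Sum>i\<in>UNIV. l $ i / \<Lambda>)"
    using \<Lambda> by (simp flip: sum_divide_distrib)
  moreover have "x + axis i 1 \<le> y + axis i 1" for i
    using \<open>x \<le> y\<close> by (simp add: less_eq_vec_def)
  ultimately show "uniformized l \<Lambda> g x \<le> uniformized l \<Lambda> g y"
    unfolding uniformized_def using \<open>0 < \<Lambda>\<close> l
    by (intro add_mono mult_left_mono sum_mono monoD[OF g] \<open>x \<le> y\<close>) auto
qed

text \<open>Indexed by the state left after the match, so that it lives on all states and needs no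
  feasibility condition.\<close>

definition match_gain ::
  "real ^ 'n \<Rightarrow> real ^ 'n \<Rightarrow> real \<Rightarrow> (nat ^ 'n \<Rightarrow> real) \<Rightarrow> nat \<Rightarrow> nat ^ 'n \<Rightarrow> real" where
  "match_gain l c \<Lambda> f k x =
     wait_action l c \<Lambda> (optimal_value l c \<Lambda> f k) (x + 1)
     - match_action l c \<Lambda> f (optimal_value l c \<Lambda> f k) (x + 1)"

definition value_excess ::
  "real ^ 'n \<Rightarrow> real ^ 'n \<Rightarrow> real \<Rightarrow> (nat ^ 'n \<Rightarrow> real) \<Rightarrow> nat \<Rightarrow> nat ^ 'n \<Rightarrow> real" where
  "value_excess l c \<Lambda> f k x =
     optimal_value l c \<Lambda> f k (x + 1) - optimal_value l c \<Lambda> f k x - f (x + 1)"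

lemma match_action_add_one:
  "match_action l c \<Lambda> f J (x + 1) = f (x + 1) + wait_action l c \<Lambda> J x"
  by (simp add: match_action_def wait_action_def)

text \<open>Waiting costs are linear, so their difference is constant. The weights of
  \<open>uniformized\<close> sum to 1, so moving \<open>f\<close> inside it leaves the expected
  increment of \<open>f\<close> at one arrival.\<close>

lemma match_gain_eq:
  "match_gain l c \<Lambda> f k x =
     waiting_cost c 1 / \<Lambda> + uniformized l \<Lambda> (value_excess l c \<Lambda> f k) x
     + (\<Sum>i\<in>UNIV. l $ i / \<Lambda> * (f (x + 1 + axis i 1) - f (x + 1)))"
proof -
  have w: "waiting_cost c (x + 1) = waiting_cost c x + waiting_cost c 1"
    by (simp add: waiting_cost_def sum.distrib algebra_simps)
  have shift: "x + axis i 1 + 1 = x + 1 + axis i 1" for i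
    by (simp add: add_ac)
  show ?thesis
    unfolding match_gain_def match_action_add_one
    by (simp add: wait_action_def w uniformized_def value_excess_def shift add_divide_distrib
        right_diff_distrib left_diff_distrib sum_subtractf sum_distrib_right
        del: One_nat_def)
qed

lemma value_excess_Suc:
  "value_excess l c \<Lambda> f (Suc k) x =
     min (match_gain l c \<Lambda> f k x) 0
     + (if x \<in> feasible_states then max 0 (match_gain l c \<Lambda> f k (x - 1)) else 0)"
proof -
  let ?G = "wait_action l c \<Lambda> (optimal_value l c \<Lambda> f k)"
  have feas: "z + 1 \<in> feasible_states" for z :: "nat ^ 'a"
    by (simp add: feasible_states_iff less_eq_vec_def)
  \<comment> \<open>The same minimum measured from either action: \<open>upper\<close> is applied at
    \<open>x\<close>, \<open>lower\<close> at \<open>x - 1\<close>, and the common term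
    \<open>?G x\<close> then cancels.\<close>
  have upper: "optimal_value l c \<Lambda> f (Suc k) (z + 1)
      = ?G z + f (z + 1) + min (match_gain l c \<Lambda> f k z) 0"
    and lower: "optimal_value l c \<Lambda> f (Suc k) (z + 1)
      = ?G (z + 1) - max 0 (match_gain l c \<Lambda> f k z)" for z
    by (auto simp: feas match_gain_def match_action_add_one min_def max_def)
  have "optimal_value l c \<Lambda> f (Suc k) x
      = ?G x - (if x \<in> feasible_states then max 0 (match_gain l c \<Lambda> f k (x - 1)) else 0)"
  proof (cases "x \<in> feasible_states")
    case True
    then obtain z where z: "x = z + 1" "x - 1 = z"
      by (rule feasible_statesE)
    show ?thesis
      using True lower[of z] z by (simp del: optimal_value.simps)
  qed simp
  with upper[of x] show ?thesis
    by (simp add: value_excess_def del: optimal_value.simps)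
qed

lemma mono_value_excess_Suc:
  assumes gain: "mono (match_gain l c \<Lambda> f k)"
  shows "mono (value_excess l c \<Lambda> f (Suc k))"
proof
  fix x y :: "nat ^ 'a"
  assume "x \<le> y"
  then have "x - 1 \<le> y - 1"
    by (simp add: less_eq_vec_def diff_le_mono)
  have "match_gain l c \<Lambda> f k x \<le> match_gain l c \<Lambda> f k y"
    "match_gain l c \<Lambda> f k (x - 1) \<le> match_gain l c \<Lambda> f k (y - 1)"
    using \<open>x \<le> y\<close> \<open>x - 1 \<le> y - 1\<close> by (auto intro: monoD[OF gain])
  \<comment> \<open>Feasibility can only be gained on the way from \<open>x\<close> to
    \<open>y\<close>, and gaining it adds a nonnegative term.\<close>
  moreover have "x \<in> feasible_states \<Longrightarrow> y \<in> feasible_states"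
    using \<open>x \<le> y\<close> by (simp add: feasible_states_iff)
  ultimately show "value_excess l c \<Lambda> f (Suc k) x \<le> value_excess l c \<Lambda> f (Suc k) y"
    by (auto simp: value_excess_Suc min_def max_def)
qed

text \<open>The induction runs on \<open>value_excess\<close>: its monotonicity at \<open>k\<close>
  gives that of the gain at \<open>k\<close>, which gives that of the excess at
  \<open>Suc k\<close>.\<close>

lemma mono_match_gain:
  fixes l c :: "real ^ 'n"
  assumes l: "\<And>i. 0 \<le> l $ i" and \<Lambda>: "(\<Sum>i\<in>UNIV. l $ i) < \<Lambda>"
    and conv: "coordinatewise_convex f" and super: "supermodular f"
    and noninc: "coordinatewise_nonincreasing f"
  shows "mono (match_gain l c \<Lambda> f k)"
proof -
  have "0 < \<Lambda>"
    using sum_nonneg[of UNIV "\<lambda>i. l $ i"] l \<Lambda> by simp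
  have gain: "mono (match_gain l c \<Lambda> f k)" if "mono (value_excess l c \<Lambda> f k)" for k
  proof
    fix x y :: "nat ^ 'n"
    assume "x \<le> y"
    moreover from this have "x + 1 \<le> y + 1"
      by (simp add: less_eq_vec_def)
    ultimately show "match_gain l c \<Lambda> f k x \<le> match_gain l c \<Lambda> f k y"
      unfolding match_gain_eq using \<open>0 < \<Lambda>\<close> l
      by (intro add_mono order_refl sum_mono mult_left_mono
          monoD[OF mono_uniformized[OF l \<Lambda> that]]
          monoD[OF mono_forward_difference[OF conv super]]) auto
  qed
  have "mono (value_excess l c \<Lambda> f k)"
  proof (induction k)
    case 0
    \<comment> \<open>With zero terminal value the excess is \<open>- f (x + 1)\<close>; this is
      where \<open>f\<close> being nonincreasing enters.\<close>
    have "f (x + axis i 1 + 1) \<le> f (x + 1)" for x i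
      using noninc by (metis coordinatewise_nonincreasing_def add.assoc add.commute)
    then show ?case
      by (intro mono_vec_natI) (simp add: value_excess_def)
  next
    case (Suc k)
    then show ?case
      by (intro mono_value_excess_Suc gain)
  qed
  then show ?thesis by (rule gain)
qed

lemma add_one_in_matching_optimal_states_iff:
  "z + 1 \<in> matching_optimal_states l c \<Lambda> f k \<longleftrightarrow> 0 \<le> match_gain l c \<Lambda> f k z"
  by (simp add: matching_optimal_states_def match_gain_def feasible_states_iff less_eq_vec_def)

theorem proposition1:
  fixes l c :: "real ^ 'n" and \<Lambda> :: real and f :: "nat ^ 'n \<Rightarrow> real"
    and k :: nat and x y :: "nat ^ 'n"
  assumes "2 \<le> CARD('n)"
    and "\<And>i. 0 < l $ i" and "\<And>i. 0 < c $ i"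
    and "(\<Sum>i\<in>UNIV. l $ i) < \<Lambda>"
    and "\<And>z. 0 \<le> f z"
    and "coordinatewise_convex f" and "supermodular f" and "coordinatewise_nonincreasing f"
    and "x \<in> matching_optimal_states l c \<Lambda> f k"
    and "y \<in> feasible_states" and "x \<le> y"
  shows "y \<in> matching_optimal_states l c \<Lambda> f k"
proof -
  have "x \<in> feasible_states"
    using assms(9) by (simp add: matching_optimal_states_def)
  then obtain u where u: "x = u + 1"
    by (rule feasible_statesE)
  from assms(10) obtain v where v: "y = v + 1"
    by (rule feasible_statesE)
  have "u \<le> v"
    using \<open>x \<le> y\<close> unfolding u v by (simp add: less_eq_vec_def)
  have "mono (match_gain l c \<Lambda> f k)"
    using assms(2,4,6-8) by (intro mono_match_gain) (auto intro: less_imp_le)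
  \<comment> \<open>Matching is optimal exactly when the gain is nonnegative, ties included, and
    this sign passes from \<open>u\<close> up to \<open>v\<close>.\<close>
  from monoD[OF this \<open>u \<le> v\<close>] assms(9) show ?thesis
    unfolding u v add_one_in_matching_optimal_states_iff by simp
qed

end
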